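(* (Representation Formula) Let $N\ge 1$ and let $f$ be a slice polyanalytic function of order $N$ on an axially symmetric slice domain $\Omega\subset\mathbb{H}$. Let $J\in\mathbb{S}$. Then for any $q=x+Iy\in\Omega$ (with $x,y\in\mathbb{R}$, $I\in\mathbb{S}$) $$f(x+Iy)=\frac12\left[f_J(x+Jy)+f_J(x-Jy)\right]+I\frac{J}{2}\left[f_J(x-Jy)-f_J(x+Jy)\right].$$ Moreover, there exist two $\mathbb{H}$-valued functions $\alpha,\beta$ of $(x,y)$, not depending on the imaginary unit, such that whenever $x+yK\in\Omega$ for all $K\in\mathbb{S}$, one has for every $K\in\mathbb{S}$ $$\frac12\left[f_K(x+yK)+f_K(x-yK)\right]=\alpha(x,y)\quad\text{and}\quad \frac12K\left[f_K(x-yK)-f_K(x+yK)\right]=\beta(x,y).$$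
   Context: $\mathbb{H}$ denotes the quaternions, $\mathbb{S}=\{q\in\mathbb{H}: q^2=-1\}$, and for $I\in\mathbb{S}$, $\mathbb{C}_I=\mathbb{R}+\mathbb{R}I$. For $\Omega\subset\mathbb{H}$ put $\Omega_I=\Omega\cap\mathbb{C}_I$, and $f_I$ is the restriction of $f$ to $\Omega_I$. An open set $\Omega$ is axially symmetric if $x+Iy\in\Omega$ implies $x+Jy\in\Omega$ for all $J\in\mathbb{S}$. A domain (nonempty connected open set) $\Omega\subset\mathbb{H}$ is a slice domain if $\Omega\cap\mathbb{R}\neq\emptyset$ and $\Omega_I$ is a domain of $\mathbb{C}_I$ for every $I\in\mathbb{S}$. Slice polyanalytic functions: let $\Omega$ be an axially symmetric open set and $\mathcal{U}=\{(x,y)\in\mathbb{R}^2: x+Iy\in\Omega \text{ for all } I\in\mathbb{S}\}$. A function $f:\Omega\to\mathbb{H}$ is a (left) slice function if $f(x+Iy)=\alpha(x,y)+I\beta(x,y)$ for all $x+Iy\in\Omega$, $I\in\mathbb{S}$, where $\alpha,\beta:\mathcal{U}\to\mathbb{H}$ do not depend on $I$ and satisfy $\alpha(x,-y)=\alpha(x,y)$, $\beta(x,-y)=-\beta(x,y)$. If moreover $\alpha,\beta$ are of class $\mathcal{C}^N$ and $\frac{1}{2^N}(\partial_x+I\partial_y)^N(\alpha(x,y)+I\beta(x,y))=0$ for all $I\in\mathbb{S}$, then $f$ is called (left) slice polyanalytic of order $N$. *)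

theory Defs
  imports "HOL-Analysis.Analysis"
begin

section \<open>The quaternions\<close>

datatype quat = Quat (qre: real) (qi: real) (qj: real) (qk: real)

lemma quat_eq_iff:
  "p = q \<longleftrightarrow> qre p = qre q \<and> qi p = qi q \<and> qj p = qj q \<and> qk p = qk q"
  by (auto intro: quat.expand)

instantiation quat :: ring_1
begin

definition "0 = Quat 0 0 0 0"
definition "1 = Quat 1 0 0 0"
definition "p + q = Quat (qre p + qre q) (qi p + qi q) (qj p + qj q) (qk p + qk q)"
definition "p - q = Quat (qre p - qre q) (qi p - qi q) (qj p - qj q) (qk p - qk q)"
definition "- q = Quat (- qre q) (- qi q) (- qj q) (- qk q)"
definition "p * q = Quat
  (qre p * qre q - qi p * qi q - qj p * qj q - qk p * qk q)
  (qre p * qi q + qi p * qre q + qj p * qk q - qk p * qj q)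
  (qre p * qj q - qi p * qk q + qj p * qre q + qk p * qi q)
  (qre p * qk q + qi p * qj q - qj p * qi q + qk p * qre q)"

lemmas quat_ring_defs =
  zero_quat_def one_quat_def plus_quat_def minus_quat_def uminus_quat_def times_quat_def

instance
  by standard (simp_all add: quat_ring_defs algebra_simps)

end

instantiation quat :: real_algebra_1
begin

definition "r *\<^sub>R q = Quat (r * qre q) (r * qi q) (r * qj q) (r * qk q)"

instance
  by standard (simp_all add: quat_ring_defs scaleR_quat_def algebra_simps)

end

instantiation quat :: real_inner
begin

definition "inner p q = qre p * qre q + qi p * qi q + qj p * qj q + qk p * qk q" for p q :: quat
definition "norm q = sqrt (inner q q)" for q :: quat
definition "sgn q = inverse (norm q) *\<^sub>R q" for q :: quat
definition "dist p q = norm (p - q)" for p q :: quat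
definition "uniformity = (INF e\<in>{0<..}. principal {(p, q :: quat). dist p q < e})"
definition "open U \<longleftrightarrow>
  (\<forall>p\<in>U. eventually (\<lambda>(p', q). p' = p \<longrightarrow> q \<in> U) uniformity)" for U :: "quat set"

instance
proof
  fix p q s :: quat and r :: real
  show "inner p q = inner q p"
    by (simp add: inner_quat_def mult.commute)
  show "inner (p + q) s = inner p s + inner q s"
    by (simp add: inner_quat_def plus_quat_def algebra_simps)
  show "inner (r *\<^sub>R p) q = r * inner p q"
    by (simp add: inner_quat_def scaleR_quat_def algebra_simps)
  show "0 \<le> inner p p"
    by (simp add: inner_quat_def)
  show "inner p p = 0 \<longleftrightarrow> p = 0"
  proof
    assume "inner p p = 0"
    then have *: "(qre p)\<^sup>2 + (qi p)\<^sup>2 + (qj p)\<^sup>2 + (qk p)\<^sup>2 = 0"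
      by (simp add: inner_quat_def power2_eq_square)
    have "(qre p)\<^sup>2 = 0 \<and> (qi p)\<^sup>2 = 0 \<and> (qj p)\<^sup>2 = 0 \<and> (qk p)\<^sup>2 = 0"
      using * zero_le_power2[of "qre p"] zero_le_power2[of "qi p"]
        zero_le_power2[of "qj p"] zero_le_power2[of "qk p"] by linarith
    then show "p = 0"
      by (simp add: quat_eq_iff zero_quat_def)
  qed (simp add: inner_quat_def zero_quat_def)
qed (simp_all only: norm_quat_def sgn_quat_def dist_quat_def uniformity_quat_def open_quat_def)

end

instantiation quat :: real_normed_div_algebra
begin

definition "inverse q = inverse ((norm q)\<^sup>2) *\<^sub>R Quat (qre q) (- qi q) (- qj q) (- qk q)"
  for q :: quat
definition "p div q = p * inverse q" for p q :: quat

lemma norm_quat_mult: "norm (p * q) = norm p * norm q" for p q :: quat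
  unfolding norm_quat_def real_sqrt_mult[symmetric]
  by (simp add: inner_quat_def times_quat_def algebra_simps)

lemma quat_mult_inverse:
  assumes "q \<noteq> (0::quat)"
  shows "inverse q * q = 1" "q * inverse q = 1"
proof -
  let ?c = "Quat (qre q) (- qi q) (- qj q) (- qk q)"
  have n: "(norm q)\<^sup>2 = inner q q" "inner q q \<noteq> 0"
    using assms by (simp_all add: power2_norm_eq_inner)
  have "?c * q = inner q q *\<^sub>R 1" "q * ?c = inner q q *\<^sub>R 1"
    by (simp_all add: times_quat_def scaleR_quat_def one_quat_def inner_quat_def)
  then show "inverse q * q = 1" "q * inverse q = 1"
    using n by (simp_all add: inverse_quat_def)
qed

instance
  by standard
    (simp_all add: quat_mult_inverse divide_quat_def norm_quat_mult,
     simp add: inverse_quat_def zero_quat_def scaleR_quat_def)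

end


section \<open>Slices and slice domains\<close>

definition imag_sphere :: "quat set" where
  "imag_sphere = {q. q\<^sup>2 = - 1}"

definition slice_plane :: "quat \<Rightarrow> quat set" where
  "slice_plane I = {of_real x + of_real y * I | x y. True}"

definition slice :: "quat set \<Rightarrow> quat \<Rightarrow> quat set" where
  "slice \<Omega> I = \<Omega> \<inter> slice_plane I"

definition slice_restriction :: "quat set \<Rightarrow> (quat \<Rightarrow> quat) \<Rightarrow> quat \<Rightarrow> quat \<Rightarrow> quat" where
  "slice_restriction \<Omega> f I = restrict f (slice \<Omega> I)"

definition axially_symmetric :: "quat set \<Rightarrow> bool" where
  "axially_symmetric \<Omega> \<longleftrightarrow>
     (\<forall>x y. \<forall>I\<in>imag_sphere. of_real x + I * of_real y \<in> \<Omega> \<longrightarrow>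
        (\<forall>J\<in>imag_sphere. of_real x + J * of_real y \<in> \<Omega>))"

definition slice_domain :: "quat set \<Rightarrow> bool" where
  "slice_domain \<Omega> \<longleftrightarrow>
     \<Omega> \<noteq> {} \<and> open \<Omega> \<and> connected \<Omega> \<and> \<Omega> \<inter> \<real> \<noteq> {} \<and>
     (\<forall>I\<in>imag_sphere. slice \<Omega> I \<noteq> {} \<and>
        openin (top_of_set (slice_plane I)) (slice \<Omega> I) \<and> connected (slice \<Omega> I))"


section \<open>Slice polyanalytic functions\<close>

definition partial_x :: "(real \<times> real \<Rightarrow> 'a::real_normed_vector) \<Rightarrow> real \<times> real \<Rightarrow> 'a" where
  "partial_x g = (\<lambda>(x, y). vector_derivative (\<lambda>t. g (t, y)) (at x))"

definition partial_y :: "(real \<times> real \<Rightarrow> 'a::real_normed_vector) \<Rightarrow> real \<times> real \<Rightarrow> 'a" where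
  "partial_y g = (\<lambda>(x, y). vector_derivative (\<lambda>t. g (x, t)) (at y))"

text \<open>\<open>g\<close> is of class $C^k$ on \<open>U\<close>; only meant for open \<open>U\<close>.\<close>

primrec class_C_on ::
    "nat \<Rightarrow> (real \<times> real) set \<Rightarrow> (real \<times> real \<Rightarrow> 'a::real_normed_vector) \<Rightarrow> bool" where
  "class_C_on 0 U g \<longleftrightarrow> continuous_on U g"
| "class_C_on (Suc k) U g \<longleftrightarrow>
     (\<forall>p\<in>U. g differentiable (at p)) \<and>
     class_C_on k U (partial_x g) \<and> class_C_on k U (partial_y g)"

text \<open>The operator $\partial_x + I \partial_y$, with \<open>I\<close> multiplying from the left.\<close>

definition dbar :: "quat \<Rightarrow> (real \<times> real \<Rightarrow> quat) \<Rightarrow> real \<times> real \<Rightarrow> quat" where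
  "dbar I g = (\<lambda>p. partial_x g p + I * partial_y g p)"

definition stem_domain :: "quat set \<Rightarrow> (real \<times> real) set" where
  "stem_domain \<Omega> = {(x, y). \<forall>I\<in>imag_sphere. of_real x + I * of_real y \<in> \<Omega>}"

text \<open>\<open>\<alpha>\<close> and \<open>\<beta>\<close> are functions on \<^term>\<open>stem_domain \<Omega>\<close> and \<open>f\<close> is a function on \<open>\<Omega>\<close>;
  their values elsewhere are irrelevant.\<close>

definition slice_components ::
    "quat set \<Rightarrow> (quat \<Rightarrow> quat) \<Rightarrow> (real \<times> real \<Rightarrow> quat) \<Rightarrow> (real \<times> real \<Rightarrow> quat) \<Rightarrow> bool" where
  "slice_components \<Omega> f \<alpha> \<beta> \<longleftrightarrow>
     (\<forall>x y. \<forall>I\<in>imag_sphere. of_real x + I * of_real y \<in> \<Omega> \<longrightarrow>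
        f (of_real x + I * of_real y) = \<alpha> (x, y) + I * \<beta> (x, y)) \<and>
     (\<forall>(x, y)\<in>stem_domain \<Omega>. \<alpha> (x, - y) = \<alpha> (x, y) \<and> \<beta> (x, - y) = - \<beta> (x, y))"

definition slice_polyanalytic :: "nat \<Rightarrow> quat set \<Rightarrow> (quat \<Rightarrow> quat) \<Rightarrow> bool" where
  "slice_polyanalytic N \<Omega> f \<longleftrightarrow>
     (\<exists>\<alpha> \<beta>. slice_components \<Omega> f \<alpha> \<beta> \<and>
        class_C_on N (stem_domain \<Omega>) \<alpha> \<and> class_C_on N (stem_domain \<Omega>) \<beta> \<and>
        (\<forall>I\<in>imag_sphere. \<forall>p\<in>stem_domain \<Omega>.
           (1 / 2 ^ N) *\<^sub>R (dbar I ^^ N) (\<lambda>p. \<alpha> p + I * \<beta> p) p = 0))"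

end

theory Submission
  imports Defs
begin

text \<open>
  Write \<open>f (x + K y) = \<alpha> (x, y) + K \<beta> (x, y)\<close> with components independent of the
  imaginary unit \<open>K\<close>.  The conjugate point \<open>x - K y\<close> lies on the same slice, and it is
  also the point with coordinates \<open>(x, y)\<close> for the unit \<open>- K\<close>, so
  \<open>f (x - K y) = \<alpha> (x, y) - K \<beta> (x, y)\<close>.  Half the sum of the two values is therefore
  \<open>\<alpha> (x, y)\<close>, and since \<open>K\<^sup>2 = - 1\<close>, multiplying half their difference by \<open>K\<close> from the left
  gives \<open>\<beta> (x, y)\<close>: the values of \<open>f\<close> on any one slice determine the components.
  This is lemma \<open>slice_components_eq\<close>.  It is the second claim outright, and inserting the
  components found on the slice of \<open>J\<close> into \<open>f (x + I y) = \<alpha> (x, y) + I \<beta> (x, y)\<close> is the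
  first.
\<close>

lemma uminus_imag_sphere: "K \<in> imag_sphere \<Longrightarrow> - K \<in> imag_sphere"
  by (simp add: imag_sphere_def)

lemma of_real_mult_commute: "of_real r * q = q * of_real r" for q :: "'a::real_algebra_1"
  by (simp add: of_real_def)

lemma in_slice_iff: "of_real x + K * of_real y \<in> slice \<Omega> K \<longleftrightarrow> of_real x + K * of_real y \<in> \<Omega>"
  by (auto simp: slice_def slice_plane_def of_real_mult_commute)

text \<open>
  Conjugation within the slice of \<open>K\<close> is the same as passing from \<open>K\<close> to \<open>- K\<close>, so the two
  combinations below are the part of \<open>f\<close> that is even in the imaginary unit, and the odd part
  \<open>K \<beta> (x, y)\<close> with its factor \<open>K\<close> cancelled by \<open>- K = K\<inverse>\<close>.
\<close>

lemma slice_components_eq: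
  assumes "axially_symmetric \<Omega>" and comp: "slice_components \<Omega> f \<alpha> \<beta>"
    and K: "K \<in> imag_sphere" and in_\<Omega>: "of_real x + K * of_real y \<in> \<Omega>"
  defines "F \<equiv> slice_restriction \<Omega> f K"
  shows "(1 / 2) *\<^sub>R (F (of_real x + K * of_real y) + F (of_real x - K * of_real y)) = \<alpha> (x, y)"
    and "((1 / 2) *\<^sub>R K) * (F (of_real x - K * of_real y) - F (of_real x + K * of_real y))
           = \<beta> (x, y)"
proof -
  \<comment> \<open>The conjugate point is read with the unit \<open>- K\<close> for the value of \<open>f\<close>, but with the unit
    \<open>K\<close> and the coordinate \<open>- y\<close> for its membership in the slice of \<open>K\<close>.\<close>
  have conj_in: "of_real x + (- K) * of_real y \<in> \<Omega>"
    using assms(1) K in_\<Omega> uminus_imag_sphere[OF K] unfolding axially_symmetric_def by blast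
  have plus: "F (of_real x + K * of_real y) = \<alpha> (x, y) + K * \<beta> (x, y)"
    using comp K in_\<Omega> in_slice_iff[of x K y \<Omega>]
    by (simp add: F_def slice_restriction_def slice_components_def)
  have "f (of_real x + (- K) * of_real y) = \<alpha> (x, y) + (- K) * \<beta> (x, y)"
    using comp conj_in uminus_imag_sphere[OF K] unfolding slice_components_def by blast
  then have minus: "F (of_real x - K * of_real y) = \<alpha> (x, y) - K * \<beta> (x, y)"
    using conj_in in_slice_iff[of x K "- y" \<Omega>] by (simp add: F_def slice_restriction_def)
  show "(1 / 2) *\<^sub>R (F (of_real x + K * of_real y) + F (of_real x - K * of_real y)) = \<alpha> (x, y)"
    unfolding plus minus by (simp flip: scaleR_2)
  have "K * K = - 1"
    using K by (simp add: imag_sphere_def power2_eq_square)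
  then have "K * (K * \<beta> (x, y)) = - \<beta> (x, y)"
    by (simp flip: mult.assoc)
  then show "((1 / 2) *\<^sub>R K) * (F (of_real x - K * of_real y) - F (of_real x + K * of_real y))
      = \<beta> (x, y)"
    unfolding plus minus by (simp add: algebra_simps flip: scaleR_left_distrib)
qed

theorem theorem3p9:
  fixes N :: nat and \<Omega> :: "quat set" and f :: "quat \<Rightarrow> quat" and J :: quat
  assumes "N \<ge> 1"
    and "axially_symmetric \<Omega>"
    and "slice_domain \<Omega>"
    and "slice_polyanalytic N \<Omega> f"
    and "J \<in> imag_sphere"
  shows
    "(\<forall>x y :: real. \<forall>I\<in>imag_sphere. of_real x + I * of_real y \<in> \<Omega> \<longrightarrow>
        f (of_real x + I * of_real y) =
          (1 / 2) *\<^sub>R (slice_restriction \<Omega> f J (of_real x + J * of_real y)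
                    + slice_restriction \<Omega> f J (of_real x - J * of_real y))
          + I * (((1 / 2) *\<^sub>R J) *
                 (slice_restriction \<Omega> f J (of_real x - J * of_real y)
                  - slice_restriction \<Omega> f J (of_real x + J * of_real y))))
     \<and>
     (\<exists>\<alpha> \<beta> :: real \<times> real \<Rightarrow> quat. \<forall>x y :: real.
        (\<forall>K\<in>imag_sphere. of_real x + of_real y * K \<in> \<Omega>) \<longrightarrow>
        (\<forall>K\<in>imag_sphere.
           (1 / 2) *\<^sub>R (slice_restriction \<Omega> f K (of_real x + of_real y * K)
                     + slice_restriction \<Omega> f K (of_real x - of_real y * K)) = \<alpha> (x, y)
         \<and> ((1 / 2) *\<^sub>R K) *
             (slice_restriction \<Omega> f K (of_real x - of_real y * K)
              - slice_restriction \<Omega> f K (of_real x + of_real y * K)) = \<beta> (x, y)))"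
proof -
  obtain \<alpha> \<beta> where comp: "slice_components \<Omega> f \<alpha> \<beta>"
    using assms(4) unfolding slice_polyanalytic_def by blast
  note recover = slice_components_eq[OF assms(2) comp]
  show ?thesis
  proof (rule conjI; (rule exI[of _ \<alpha>], rule exI[of _ \<beta>])?;
      intro allI ballI impI conjI)
    fix x y :: real and I
    assume I: "I \<in> imag_sphere" and in_\<Omega>: "of_real x + I * of_real y \<in> \<Omega>"
    have "of_real x + J * of_real y \<in> \<Omega>"
      using assms(2,5) I in_\<Omega> unfolding axially_symmetric_def by blast
    note J = recover[OF assms(5) this]
    have "f (of_real x + I * of_real y) = \<alpha> (x, y) + I * \<beta> (x, y)"
      using comp I in_\<Omega> unfolding slice_components_def by blast
    then show "f (of_real x + I * of_real y) =
          (1 / 2) *\<^sub>R (slice_restriction \<Omega> f J (of_real x + J * of_real y)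
                    + slice_restriction \<Omega> f J (of_real x - J * of_real y))
          + I * (((1 / 2) *\<^sub>R J) *
                 (slice_restriction \<Omega> f J (of_real x - J * of_real y)
                  - slice_restriction \<Omega> f J (of_real x + J * of_real y)))"
      by (simp only: J)
  next
    fix x y :: real and K
    assume "\<forall>K\<in>imag_sphere. of_real x + of_real y * K \<in> \<Omega>" and K: "K \<in> imag_sphere"
    then have in_\<Omega>: "of_real x + K * of_real y \<in> \<Omega>"
      by (simp add: of_real_mult_commute)
    show "(1 / 2) *\<^sub>R (slice_restriction \<Omega> f K (of_real x + of_real y * K)
                     + slice_restriction \<Omega> f K (of_real x - of_real y * K)) = \<alpha> (x, y)"
      and "((1 / 2) *\<^sub>R K) *
             (slice_restriction \<Omega> f K (of_real x - of_real y * K)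
              - slice_restriction \<Omega> f K (of_real x + of_real y * K)) = \<beta> (x, y)"
      unfolding of_real_mult_commute[of y K] by (fact recover[OF K in_\<Omega>])+
  qed
qed

end
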